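(* Let $r,c,t$ be positive integers. For each $T_{bottom}\in Bottom(r,c,t)$, the interval $[T_{bottom},T_{top}]$ in $SSYT(r,c,t)$ is a Boolean algebra, and as a set $SSYT(r,c,t)=\bigcup_{T_{bottom}\in Bottom(r,c,t)}[T_{bottom},T_{top}]$, the union being disjoint.
   Context: $SSYT(r,c,t)$ is the set of $r\times c$ arrays $T$ (rows $1,\dots,r$ top to bottom) with entries in $\{0,\dots,r+t-1\}$, weakly increasing along rows and strictly increasing down columns, partially ordered entrywise. An occurrence of $v$ in row $R$, column $j$, is free if $R=1$ or the entry directly above is not $v-1$. $D(T)$ is the set of pairs $(R,i)$ with $i$ odd occurring in row $R$ with an odd number of free occurrences (such an $i$ may be decremented: replace the leftmost $i$ in row $R$ by $i-1$). $E(T)$ is the set of pairs $(R,i)$ with $i$ even, $i<r+t-1$, $i$ occurring in row $R$, the rightmost $i$ in row $R$ not having $i+1$ immediately below it (vacuous if $R=r$), and the number of free occurrences of $i+1$ in row $R$ even (possibly zero) (such an $i$ may be incremented: replace the rightmost $i$ in row $R$ by $i+1$). $Bottom(r,c,t)=\{T\in SSYT(r,c,t): D(T)=\varnothing\}$. For $T_{bottom}\in Bottom(r,c,t)$, $T_{top}$ is the array obtained from $T_{bottom}$ by performing the increment for every $(R,i)\in E(T_{bottom})$. *)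

theory Defs
  imports "HOL-Algebra.Complete_Lattice" "HOL-Library.Disjoint_Sets"
begin

text \<open>
  An \<open>r \<times> c\<close> array is an extensional function on \<open>{1..r} \<times> {1..c}\<close>; \<open>T (R, j)\<close> is the entry in
  row \<open>R\<close> (row 1 on top) and column \<open>j\<close>. Extensionality makes the entrywise order antisymmetric.
\<close>

type_synonym tableau = "nat \<times> nat \<Rightarrow> nat"

definition SSYT :: "nat \<Rightarrow> nat \<Rightarrow> nat \<Rightarrow> tableau set" where
  "SSYT r c t = {T \<in> {1..r} \<times> {1..c} \<rightarrow>\<^sub>E {0..r + t - 1}.
     (\<forall>R\<in>{1..r}. \<forall>j\<in>{1..c}. \<forall>k\<in>{1..c}. j < k \<longrightarrow> T (R, j) \<le> T (R, k)) \<and>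
     (\<forall>j\<in>{1..c}. \<forall>R\<in>{1..r}. \<forall>S\<in>{1..r}. R < S \<longrightarrow> T (R, j) < T (S, j))}"

definition SSYT_poset :: "nat \<Rightarrow> nat \<Rightarrow> nat \<Rightarrow> tableau gorder" where
  "SSYT_poset r c t =
     \<lparr>carrier = SSYT r c t, eq = (=),
      le = (\<lambda>T U. \<forall>R\<in>{1..r}. \<forall>j\<in>{1..c}. T (R, j) \<le> U (R, j))\<rparr>"

definition occurrences :: "nat \<Rightarrow> tableau \<Rightarrow> nat \<Rightarrow> nat \<Rightarrow> nat set" where
  "occurrences c T R v = {j \<in> {1..c}. T (R, j) = v}"

text \<open>
  The condition that the entry above is not \<open>v - 1\<close> is written with \<open>+ 1\<close> on the other side, to avoid
  truncated subtraction at \<open>v = 0\<close>.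
\<close>

definition free_occurrences :: "nat \<Rightarrow> tableau \<Rightarrow> nat \<Rightarrow> nat \<Rightarrow> nat set" where
  "free_occurrences c T R v = {j \<in> occurrences c T R v. R = 1 \<or> T (R - 1, j) + 1 \<noteq> v}"

definition D_set :: "nat \<Rightarrow> nat \<Rightarrow> tableau \<Rightarrow> (nat \<times> nat) set" where
  "D_set r c T = {(R, i). R \<in> {1..r} \<and> odd i \<and> occurrences c T R i \<noteq> {} \<and>
     odd (card (free_occurrences c T R i))}"

definition E_set :: "nat \<Rightarrow> nat \<Rightarrow> nat \<Rightarrow> tableau \<Rightarrow> (nat \<times> nat) set" where
  "E_set r c t T = {(R, i). R \<in> {1..r} \<and> even i \<and> i < r + t - 1 \<and> occurrences c T R i \<noteq> {} \<and>
     (R = r \<or> T (R + 1, Max (occurrences c T R i)) \<noteq> i + 1) \<and>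
     even (card (free_occurrences c T R (i + 1)))}"

definition Bottom :: "nat \<Rightarrow> nat \<Rightarrow> nat \<Rightarrow> tableau set" where
  "Bottom r c t = {T \<in> SSYT r c t. D_set r c T = {}}"

definition increment :: "nat \<Rightarrow> nat \<times> nat \<Rightarrow> tableau \<Rightarrow> tableau" where
  "increment c = (\<lambda>(R, i) T. T((R, Max (occurrences c T R i)) := i + 1))"

text \<open>
  All increments at once; they act on pairwise distinct cells and do not interfere, so that
  performing them one after another, in any order, gives the same array
  (lemma \<open>fold_increment_eq_T_top\<close>).
\<close>

definition T_top :: "nat \<Rightarrow> nat \<Rightarrow> nat \<Rightarrow> tableau \<Rightarrow> tableau" where
  "T_top r c t T = (\<lambda>(R, j).
     if \<exists>i. (R, i) \<in> E_set r c t T \<and> j = Max (occurrences c T R i)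
     then T (R, j) + 1 else T (R, j))"

lemma fold_increment_eq_T_top:
  assumes "distinct ps" and "set ps = E_set r c t T"
  shows "fold (increment c) ps T = T_top r c t T"
proof -
  have fin: "finite (occurrences c U R i)" for U R i
    by (simp add: occurrences_def)
  have "fold (increment c) qs T = (\<lambda>(R, j).
          if \<exists>i. (R, i) \<in> set qs \<and> j = Max (occurrences c T R i)
          then T (R, j) + 1 else T (R, j))" (is "_ = ?U qs")
    if "distinct qs" "set qs \<subseteq> E_set r c t T" for qs
    using that
  proof (induction qs rule: rev_induct)
    case Nil
    then show ?case by auto
  next
    case (snoc p qs)
    obtain R i where p: "p = (R, i)" by (cases p)
    have new: "(R, i) \<notin> set qs" using snoc.prems p by auto
    have Max_in: "T (S, Max (occurrences c T S k)) = k" if "(S, k) \<in> E_set r c t T" for S k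
      using Max_in[OF fin, of T S k] that by (auto simp: E_set_def occurrences_def)
    have ev: "even k" if "(S, k) \<in> set (qs @ [p])" for S k
      using that snoc.prems by (auto simp: E_set_def)
    have "(?U qs (R, j) = i) = (T (R, j) = i)" for j
    proof (cases "\<exists>k. (R, k) \<in> set qs \<and> j = Max (occurrences c T R k)")
      case True
      then obtain k where k: "(R, k) \<in> set qs" "j = Max (occurrences c T R k)" by blast
      have "T (R, j) = k" using Max_in k snoc.prems by auto
      moreover have "k \<noteq> i" using k new by auto
      moreover have "even k" "even i" using ev k p by auto
      then have "Suc k \<noteq> i" by auto
      moreover have "?U qs (R, j) = T (R, j) + 1" using True by simp
      ultimately show ?thesis by simp
    next
      case False
      then have "?U qs (R, j) = T (R, j)" by simp
      then show ?thesis by simp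
    qed
    then have occ: "occurrences c (?U qs) R i = occurrences c T R i"
      unfolding occurrences_def by blast
    have iv: "T (R, Max (occurrences c T R i)) = i" using Max_in snoc.prems p by auto
    have "fold (increment c) (qs @ [p]) T = increment c p (?U qs)"
      using snoc by simp
    also have "\<dots> = (?U qs)((R, Max (occurrences c T R i)) := i + 1)"
      by (simp only: increment_def p prod.case occ)
    also have "\<dots> = ?U (qs @ [p])"
    proof
      fix x :: "nat \<times> nat"
      show "((?U qs)((R, Max (occurrences c T R i)) := i + 1)) x = ?U (qs @ [p]) x"
        using iv by (cases x) (auto simp: p)
    qed
    finally show ?case .
  qed
  from this[of ps] assms show ?thesis by (simp add: T_top_def)
qed

text \<open>
  A Boolean algebra as a partially ordered set: a bounded distributive complemented lattice.
  The one-element lattice is included.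
\<close>

locale boolean_lattice = bounded_lattice +
  assumes distributive: "\<lbrakk>x \<in> carrier L; y \<in> carrier L; z \<in> carrier L\<rbrakk>
      \<Longrightarrow> x \<sqinter> (y \<squnion> z) = (x \<sqinter> y) \<squnion> (x \<sqinter> z)"
    and complemented: "x \<in> carrier L \<Longrightarrow> \<exists>y\<in>carrier L. x \<sqinter> y = \<bottom> \<and> x \<squnion> y = \<top>"

end

theory Submission
  imports Defs
begin

text \<open>
  Pair each even value with its successor. Within a row, the number of free occurrences of an odd
  value \<open>i + 1\<close> can be varied independently of everything else by moving the boundary between the
  \<open>i\<close>s and the \<open>i + 1\<close>s, and \<open>D(T)\<close>, \<open>E(T)\<close> only see the parity of this number. On a
  bottom array all these numbers are even; adding 1 on any set \<open>X\<close> of cells selected by \<open>E\<close>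
  yields a tableau whose \<open>D\<close>-cells are exactly \<open>X\<close>. Hence the interval is a copy of the power
  set of the \<open>E\<close>-cells, and subtracting 1 on the \<open>D\<close>-cells recovers from any tableau the unique
  bottom array whose interval contains it.
\<close>

section \<open>Transport of the Boolean algebra structure from a power set\<close>

text \<open>Since \<open>\<phi>\<close> is onto the carrier and both preserves and reflects the
  order, bounds in \<open>L\<close> correspond to bounds among subsets of \<open>C\<close>. Joins,
  meets and complements are therefore the images of unions, intersections and set
  complements.\<close>

lemma boolean_lattice_if_Pow_iso:
  fixes L (structure)
  assumes eq: "eq L = (=)"
    and bij: "bij_betw \<phi> (Pow C) (carrier L)"
    and le: "\<And>X Y. X \<subseteq> C \<Longrightarrow> Y \<subseteq> C \<Longrightarrow> \<phi> X \<sqsubseteq> \<phi> Y \<longleftrightarrow> X \<subseteq> Y"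
  shows "boolean_lattice L"
proof -
  have carr: "\<phi> X \<in> carrier L" if "X \<subseteq> C" for X
    using bij that by (auto simp: bij_betw_def)
  have ex: "\<exists>X. X \<subseteq> C \<and> x = \<phi> X" if "x \<in> carrier L" for x
    using bij that by (auto simp: bij_betw_def)
  interpret partial_order L
  proof
    fix x y z assume "x \<sqsubseteq> y" "y \<sqsubseteq> z" "x \<in> carrier L" "y \<in> carrier L" "z \<in> carrier L"
    then show "x \<sqsubseteq> z" using le ex by (metis subset_trans)
  next
    fix x y assume "x \<sqsubseteq> y" "y \<sqsubseteq> x" "x \<in> carrier L" "y \<in> carrier L"
    then show "x .= y" unfolding eq using le ex by (metis subset_antisym)
  next
    fix x assume "x \<in> carrier L"
    then show "x \<sqsubseteq> x" using le ex by (metis subset_refl)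
  qed (auto simp: eq)
  have lub: "least L (\<phi> (X \<union> Y)) (Upper L {\<phi> X, \<phi> Y})" if "X \<subseteq> C" "Y \<subseteq> C" for X Y
    unfolding least_def Upper_def using that by (auto simp: carr le dest!: ex)
  have glb: "greatest L (\<phi> (X \<inter> Y)) (Lower L {\<phi> X, \<phi> Y})" if "X \<subseteq> C" "Y \<subseteq> C" for X Y
    unfolding greatest_def Lower_def using that
    by (auto simp: carr le le_infI1 dest!: ex)
  have bot: "least L (\<phi> {}) (carrier L)" and top: "greatest L (\<phi> C) (carrier L)"
    unfolding least_def greatest_def by (auto simp: carr le dest!: ex)
  interpret bounded_lattice L
  proof
    fix x y assume "x \<in> carrier L" "y \<in> carrier L"
    then obtain X Y where "X \<subseteq> C" "Y \<subseteq> C" "x = \<phi> X" "y = \<phi> Y"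
      using ex by metis
    then show "\<exists>s. least L s (Upper L {x, y})" "\<exists>s. greatest L s (Lower L {x, y})"
      using lub glb by metis+
  next
    show "\<exists>x. least L x (carrier L)" "\<exists>x. greatest L x (carrier L)"
      using bot top by blast+
  qed
  have join: "\<phi> X \<squnion> \<phi> Y = \<phi> (X \<union> Y)" if "X \<subseteq> C" "Y \<subseteq> C" for X Y
    \<comment> \<open>The join is a chosen least upper bound. \<open>joinI\<close> with an equality
      as its predicate reduces the claim to uniqueness of least upper bounds; the meet is
      dual.\<close>
    using joinI[of "\<phi> X" "\<phi> Y" "\<lambda>l. l = \<phi> (X \<union> Y)"] lub[OF that] least_unique carr[OF that(1)] carr[OF that(2)] by metis
  have meet: "\<phi> X \<sqinter> \<phi> Y = \<phi> (X \<inter> Y)" if "X \<subseteq> C" "Y \<subseteq> C" for X Y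
    using meetI[of "\<phi> X" "\<phi> Y" "\<lambda>l. l = \<phi> (X \<inter> Y)"] glb[OF that] greatest_unique carr[OF that(1)] carr[OF that(2)] by metis
  have bt: "\<bottom> = \<phi> {}" "\<top> = \<phi> C"
    using least_unique[OF bottom_least bot] greatest_unique[OF top_greatest top] by auto
  show ?thesis
  proof
    fix x y z assume "x \<in> carrier L" "y \<in> carrier L" "z \<in> carrier L"
    then obtain X Y Z where "X \<subseteq> C" "Y \<subseteq> C" "Z \<subseteq> C" "x = \<phi> X" "y = \<phi> Y" "z = \<phi> Z"
      using ex by metis
    then show "x \<sqinter> (y \<squnion> z) = (x \<sqinter> y) \<squnion> (x \<sqinter> z)"
      by (simp add: join meet le_infI1 Int_Un_distrib)
  next
    fix x assume "x \<in> carrier L"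
    then obtain X where X: "X \<subseteq> C" "x = \<phi> X" using ex by blast
    then have "X \<union> (C - X) = C" by blast
    with X show "\<exists>y\<in>carrier L. x \<sqinter> y = \<bottom> \<and> x \<squnion> y = \<top>"
      by (intro bexI[of _ "\<phi> (C - X)"]) (auto simp: join meet bt carr)
  qed
qed

section \<open>Tableaux and the cells selected by \<open>E_set\<close> and
  \<open>D_set\<close>\<close>

lemma SSYT_mem: "T \<in> SSYT r c t \<Longrightarrow> T \<in> {1..r} \<times> {1..c} \<rightarrow>\<^sub>E {0..r + t - 1}"
  by (simp add: SSYT_def)

lemma SSYT_row:
  assumes "T \<in> SSYT r c t" "R \<in> {1..r}" "j \<in> {1..c}" "k \<in> {1..c}" "j \<le> k"
  shows "T (R, j) \<le> T (R, k)"
  using assms by (cases "j = k") (auto simp: SSYT_def)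

lemma SSYT_column:
  assumes "T \<in> SSYT r c t" "R \<in> {1..r}" "S \<in> {1..r}" "j \<in> {1..c}" "R < S"
  shows "T (R, j) < T (S, j)"
  using assms by (auto simp: SSYT_def)

lemma SSYT_above:
  assumes "T \<in> SSYT r c t" "R \<in> {1..r}" "R \<noteq> 1" "j \<in> {1..c}"
  shows "T (R - 1, j) < T (R, j)"
  using assms by (intro SSYT_column) auto

lemma finite_occurrences [simp]: "finite (occurrences c T R v)"
  by (simp add: occurrences_def)

lemma finite_free_occurrences [simp]: "finite (free_occurrences c T R v)"
  by (simp add: free_occurrences_def)

text \<open>Cells replace pairs of row and value because raising an entry changes its value but not
  its position. Sets of cells can thus be compared before and after raising, as in
  \<open>D_cells_bump\<close>.\<close>

definition E_cells :: "nat \<Rightarrow> nat \<Rightarrow> nat \<Rightarrow> tableau \<Rightarrow> (nat \<times> nat) set" where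
  "E_cells r c t T = (\<lambda>(R, i). (R, Max (occurrences c T R i))) ` E_set r c t T"

definition D_cells :: "nat \<Rightarrow> nat \<Rightarrow> tableau \<Rightarrow> (nat \<times> nat) set" where
  "D_cells r c T = (\<lambda>(R, i). (R, Min (occurrences c T R i))) ` D_set r c T"

definition bump :: "tableau \<Rightarrow> (nat \<times> nat) set \<Rightarrow> tableau" where
  "bump T X = (\<lambda>p. if p \<in> X then T p + 1 else T p)"

definition lower :: "nat \<Rightarrow> nat \<Rightarrow> tableau \<Rightarrow> tableau" where
  "lower r c T = (\<lambda>p. if p \<in> D_cells r c T then T p - 1 else T p)"

text \<open>The right-hand side fixes \<open>i\<close> as \<open>T (R, j)\<close>, which eliminates
  the existential over \<open>i\<close> when membership of a cell is unfolded in
  \<open>E_cells_iff\<close>.\<close>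

lemma Max_occurrences_iff:
  "occurrences c T R i \<noteq> {} \<and> j = Max (occurrences c T R i) \<longleftrightarrow>
     j \<in> {1..c} \<and> T (R, j) = i \<and> (\<forall>k\<in>{j<..c}. T (R, k) \<noteq> i)" (is "?l \<longleftrightarrow> ?r")
proof
  assume l: ?l
  then have "j \<in> occurrences c T R i" using Max_in[of "occurrences c T R i"] by simp
  moreover have "k \<le> j" if "k \<in> occurrences c T R i" for k
    using that l Max_ge[of "occurrences c T R i" k] by simp
  then have "k \<notin> occurrences c T R i" if "\<not> k \<le> j" for k using that by blast
  ultimately show ?r by (auto simp: occurrences_def)
next
  assume r: ?r
  then have j: "j \<in> occurrences c T R i" by (simp add: occurrences_def)
  moreover have "k \<le> j" if "k \<in> occurrences c T R i" for k
    using that r by (cases "k > j") (auto simp: occurrences_def)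
  ultimately have "Max (occurrences c T R i) = j" by (intro Max_eqI) auto
  with j show ?l by auto
qed

lemma Min_occurrences_iff:
  "occurrences c T R i \<noteq> {} \<and> j = Min (occurrences c T R i) \<longleftrightarrow>
     j \<in> {1..c} \<and> T (R, j) = i \<and> (\<forall>k\<in>{1..<j}. T (R, k) \<noteq> i)" (is "?l \<longleftrightarrow> ?r")
proof
  assume l: ?l
  then have "j \<in> occurrences c T R i" using Min_in[of "occurrences c T R i"] by simp
  moreover have "j \<le> k" if "k \<in> occurrences c T R i" for k
    using that l Min_le[of "occurrences c T R i" k] by simp
  then have "k \<notin> occurrences c T R i" if "\<not> j \<le> k" for k using that by blast
  ultimately show ?r by (auto simp: occurrences_def)
next
  assume r: ?r
  then have j: "j \<in> occurrences c T R i" by (simp add: occurrences_def)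
  moreover have "j \<le> k" if "k \<in> occurrences c T R i" for k
    using that r by (cases "k < j") (auto simp: occurrences_def)
  ultimately have "Min (occurrences c T R i) = j" by (intro Min_eqI) auto
  with j show ?l by auto
qed

lemma E_cells_iff:
  "(R, j) \<in> E_cells r c t T \<longleftrightarrow> R \<in> {1..r} \<and> j \<in> {1..c} \<and> even (T (R, j)) \<and> T (R, j) < r + t - 1 \<and>
     (\<forall>k\<in>{j<..c}. T (R, k) \<noteq> T (R, j)) \<and> (R = r \<or> T (R + 1, j) \<noteq> T (R, j) + 1) \<and>
     even (card (free_occurrences c T R (T (R, j) + 1)))"
proof -
  have "(R, j) \<in> E_cells r c t T \<longleftrightarrow>
      (\<exists>i. (R, i) \<in> E_set r c t T \<and> j = Max (occurrences c T R i))"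
    by (auto simp: E_cells_def)
  also have "\<dots> \<longleftrightarrow> (\<exists>i. (occurrences c T R i \<noteq> {} \<and> j = Max (occurrences c T R i)) \<and>
      R \<in> {1..r} \<and> even i \<and> i < r + t - 1 \<and> (R = r \<or> T (R + 1, j) \<noteq> i + 1) \<and>
      even (card (free_occurrences c T R (i + 1))))"
    unfolding E_set_def by blast
  finally show ?thesis unfolding Max_occurrences_iff by blast
qed

lemma D_cells_iff:
  "(R, j) \<in> D_cells r c T \<longleftrightarrow> R \<in> {1..r} \<and> j \<in> {1..c} \<and> odd (T (R, j)) \<and>
     (\<forall>k\<in>{1..<j}. T (R, k) \<noteq> T (R, j)) \<and> odd (card (free_occurrences c T R (T (R, j))))"
proof -
  have "(R, j) \<in> D_cells r c T \<longleftrightarrow>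
      (\<exists>i. (R, i) \<in> D_set r c T \<and> j = Min (occurrences c T R i))"
    by (auto simp: D_cells_def)
  also have "\<dots> \<longleftrightarrow> (\<exists>i. (occurrences c T R i \<noteq> {} \<and> j = Min (occurrences c T R i)) \<and>
      R \<in> {1..r} \<and> odd i \<and> odd (card (free_occurrences c T R i)))"
    unfolding D_set_def by blast
  finally show ?thesis unfolding Min_occurrences_iff by blast
qed

lemma T_top_eq_bump: "T_top r c t T = bump T (E_cells r c t T)"
proof
  fix p :: "nat \<times> nat"
  obtain R j where p: "p = (R, j)" by fastforce
  have "p \<in> E_cells r c t T \<longleftrightarrow> (\<exists>i. (R, i) \<in> E_set r c t T \<and> j = Max (occurrences c T R i))"
    by (auto simp: E_cells_def p)
  then show "T_top r c t T p = bump T (E_cells r c t T) p"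
    by (simp add: T_top_def bump_def p)
qed

text \<open>A value absent from a row has zero free occurrences there, so evenness extends to all
  odd values.\<close>

lemma Bottom_iff:
  "T \<in> Bottom r c t \<longleftrightarrow> T \<in> SSYT r c t \<and>
     (\<forall>R\<in>{1..r}. \<forall>v. odd v \<longrightarrow> even (card (free_occurrences c T R v)))"
proof -
  have "free_occurrences c T R v = {}" if "occurrences c T R v = {}" for R v
    using that by (simp add: free_occurrences_def)
  then show ?thesis
    unfolding Bottom_def D_set_def by (auto, metis card.empty even_zero)
qed

section \<open>Raising a set of E-cells\<close>

lemma E_cells_right_less:
  assumes "T \<in> SSYT r c t" "(R, j) \<in> E_cells r c t T" "k \<in> {j<..c}"
  shows "T (R, j) < T (R, k)"
proof -
  have "T (R, k) \<noteq> T (R, j)" "R \<in> {1..r}" "j \<in> {1..c}"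
    using assms unfolding E_cells_iff by blast+
  then show ?thesis using SSYT_row[OF assms(1), of R j k] assms(3) by auto
qed

text \<open>Column strictness together with the exclusion of \<open>i + 1\<close> directly below
  leaves a gap of at least two, which is the room needed to raise the entry.\<close>

lemma E_cells_below_greater:
  assumes "T \<in> SSYT r c t" "(R, j) \<in> E_cells r c t T" "S \<in> {R<..r}"
  shows "T (R, j) + 1 < T (S, j)"
proof -
  have "T (R, j) < T (R + 1, j)" "T (R + 1, j) \<noteq> T (R, j) + 1"
    using assms SSYT_column[of T r c t R "R + 1" j] by (auto simp: E_cells_iff)
  moreover have "T (R + 1, j) \<le> T (S, j)"
    using assms SSYT_column[of T r c t "R + 1" S j]
    by (cases "S = R + 1") (auto simp: E_cells_iff)
  ultimately show ?thesis by linarith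
qed

text \<open>A raised entry is strictly smaller than those to its right, at least two smaller than
  those below, and less than the maximal value. As no entry ever decreases, any set of E-cells can
  be raised simultaneously.\<close>

lemma bump_in_SSYT:
  assumes T: "T \<in> SSYT r c t" and X: "X \<subseteq> E_cells r c t T"
  shows "bump T X \<in> SSYT r c t"
proof -
  have box: "X \<subseteq> {1..r} \<times> {1..c}"
    using X by (auto simp: E_cells_iff dest!: subsetD)
  have "bump T X \<in> {1..r} \<times> {1..c} \<rightarrow>\<^sub>E {0..r + t - 1}"
  proof (rule PiE_I)
    fix p assume "p \<in> {1..r} \<times> {1..c}"
    then show "bump T X p \<in> {0..r + t - 1}"
      using SSYT_mem[OF T] X by (cases p) (auto simp: bump_def E_cells_iff PiE_def Pi_def dest!: subsetD)
  next
    fix p assume "p \<notin> {1..r} \<times> {1..c}"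
    then show "bump T X p = undefined"
      using PiE_arb[OF SSYT_mem[OF T], of p] box by (auto simp: bump_def)
  qed
  moreover have "bump T X (R, j) \<le> bump T X (R, k)"
    if "R \<in> {1..r}" "j \<in> {1..c}" "k \<in> {1..c}" "j < k" for R j k
  proof (cases "(R, j) \<in> X")
    case True
    then have "T (R, j) < T (R, k)" using E_cells_right_less[OF T, of R j k] X that by auto
    then show ?thesis by (auto simp: bump_def)
  next
    case False
    then show ?thesis using SSYT_row[OF T, of R j k] that by (auto simp: bump_def)
  qed
  moreover have "bump T X (R, j) < bump T X (S, j)"
    if "j \<in> {1..c}" "R \<in> {1..r}" "S \<in> {1..r}" "R < S" for R S j
  proof (cases "(R, j) \<in> X")
    case True
    then have "T (R, j) + 1 < T (S, j)" using E_cells_below_greater[OF T, of R j S] X that by auto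
    then show ?thesis by (auto simp: bump_def)
  next
    case False
    then show ?thesis using SSYT_column[OF T, of R S j] that by (auto simp: bump_def)
  qed
  ultimately show ?thesis by (auto simp: SSYT_def)
qed

text \<open>Only even entries are raised, so each new \<open>v + 1\<close> comes from a
  \<open>v\<close> in \<open>X\<close>. It is free because the entry above was already below
  \<open>v\<close>. Old occurrences keep their status: an entry \<open>v\<close> above a
  \<open>v + 1\<close> is not raised, by the gap below E-cells, and a raised entry is odd and cannot
  become \<open>v\<close>.\<close>

lemma free_occurrences_bump:
  assumes T: "T \<in> SSYT r c t" and X: "X \<subseteq> E_cells r c t T" and R: "R \<in> {1..r}" and v: "even v"
  shows "free_occurrences c (bump T X) R (v + 1) =
    free_occurrences c T R (v + 1) \<union> {j. (R, j) \<in> X \<and> T (R, j) = v}"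
proof -
  have ev: "even (T p)" if "p \<in> X" for p
    using that X by (cases p) (auto simp: E_cells_iff dest!: subsetD)
  have cols: "j \<in> {1..c}" if "(S, j) \<in> X" for S j
    using that X by (auto simp: E_cells_iff dest!: subsetD)
  have occ: "bump T X (R, j) = v + 1 \<longleftrightarrow> T (R, j) = v + 1 \<or> (R, j) \<in> X \<and> T (R, j) = v" for j
    using ev[of "(R, j)"] v by (auto simp: bump_def)
  have above: "bump T X (R - 1, j) = v \<longleftrightarrow> T (R - 1, j) = v"
    if "j \<in> {1..c}" "R \<noteq> 1" "T (R, j) = v + 1 \<or> (R, j) \<in> X \<and> T (R, j) = v" for j
  proof (cases "(R - 1, j) \<in> X")
    case True
    then have "T (R - 1, j) + 1 < T (R, j)"
      using E_cells_below_greater[OF T, of "R - 1" j R] X R that by auto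
    then show ?thesis using that ev[OF True] v by (auto simp: bump_def)
  qed (simp add: bump_def)
  have new: "T (R - 1, j) \<noteq> v" if "j \<in> {1..c}" "R \<noteq> 1" "T (R, j) = v" for j
    using SSYT_above[OF T R] that by fastforce
  show ?thesis
    using above new occ cols unfolding free_occurrences_def occurrences_def by auto
qed

text \<open>Raising the rightmost \<open>v\<close> of a row makes it the leftmost
  \<open>v + 1\<close> and adds one free occurrence to an even number. So it becomes a D-cell, and
  values not touched by \<open>X\<close> keep even counts.\<close>

lemma D_cells_bump:
  assumes T: "T \<in> Bottom r c t" and X: "X \<subseteq> E_cells r c t T"
  shows "D_cells r c (bump T X) = X"
proof -
  have S: "T \<in> SSYT r c t" using T by (simp add: Bottom_iff)
  have XE: "(R, j) \<in> E_cells r c t T" if "(R, j) \<in> X" for R j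
    using that X by blast
  \<comment> \<open>A row has at most one E-cell per value, so the count changes by at most
    one.\<close>
  have uniq: "{k. (R, k) \<in> X \<and> T (R, k) = T (R, j)} = {j}" if "(R, j) \<in> X" for R j
  proof -
    have "k = j" if k: "(R, k) \<in> X" "T (R, k) = T (R, j)" for k
    proof (rule ccontr)
      assume "k \<noteq> j"
      then have "k \<in> {j<..c} \<or> j \<in> {k<..c}"
        using XE[OF k(1)] XE[OF \<open>(R, j) \<in> X\<close>] by (auto simp: E_cells_iff)
      then show False
        using E_cells_right_less[OF S XE] \<open>(R, j) \<in> X\<close> k by (metis less_irrefl)
    qed
    with that show ?thesis by blast
  qed
  have parity: "odd (card (free_occurrences c (bump T X) R (v + 1))) \<longleftrightarrow>
      (\<exists>j. (R, j) \<in> X \<and> T (R, j) = v)" if R: "R \<in> {1..r}" and v: "even v" for R v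
  proof (cases "\<exists>j. (R, j) \<in> X \<and> T (R, j) = v")
    case True
    then obtain j where j: "(R, j) \<in> X" "T (R, j) = v" by blast
    have "free_occurrences c (bump T X) R (v + 1) = insert j (free_occurrences c T R (v + 1))"
      using free_occurrences_bump[OF S X R v] uniq[OF j(1)] j(2) by auto
    moreover have "j \<notin> free_occurrences c T R (v + 1)"
      using j by (simp add: free_occurrences_def occurrences_def)
    ultimately have "card (free_occurrences c (bump T X) R (v + 1)) =
        Suc (card (free_occurrences c T R (v + 1)))" by simp
    moreover have "even (card (free_occurrences c T R (v + 1)))"
      using T R v by (simp add: Bottom_iff)
    ultimately show ?thesis using True by simp
  next
    case False
    then have "free_occurrences c (bump T X) R (v + 1) = free_occurrences c T R (v + 1)"
      using free_occurrences_bump[OF S X R v] by auto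
    then show ?thesis using T R v False by (simp add: Bottom_iff)
  qed
  have "(R, j) \<in> D_cells r c (bump T X) \<longleftrightarrow> (R, j) \<in> X" for R j
  proof
    assume X': "(R, j) \<in> X"
    note E = XE[OF X', unfolded E_cells_iff]
    have "bump T X (R, k) \<noteq> bump T X (R, j)" if k: "k \<in> {1..<j}" for k
    proof (cases "(R, k) \<in> X")
      case True
      then show ?thesis
        using E_cells_right_less[OF S XE[OF True], of j] E k X' by (auto simp: bump_def)
    next
      case False
      then show ?thesis
        using SSYT_row[OF S, of R k j] E k X' by (auto simp: bump_def)
    qed
    moreover have "odd (card (free_occurrences c (bump T X) R (bump T X (R, j))))"
      using parity[of R "T (R, j)"] E X' by (auto simp: bump_def)
    ultimately show "(R, j) \<in> D_cells r c (bump T X)"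
      using E X' by (auto simp: D_cells_iff bump_def)
  next
    assume D: "(R, j) \<in> D_cells r c (bump T X)"
    then have "odd (bump T X (R, j))" by (simp add: D_cells_iff)
    then obtain v where v: "even v" "bump T X (R, j) = v + 1" by (elim oddE) (metis dvd_triv_left)
    with D parity[of R v] obtain k where k: "(R, k) \<in> X" "T (R, k) = v"
      by (auto simp: D_cells_iff)
    note E = XE[OF k(1), unfolded E_cells_iff]
    \<comment> \<open>The raised cell \<open>k\<close> and the D-cell \<open>j\<close> both hold
      \<open>v + 1\<close> in the new array. Being leftmost, \<open>j\<close> is not to the right of
      \<open>k\<close>; if it is to the left, its old entry was at most \<open>v\<close>, so it was
      raised too.\<close>
    have "\<not> k < j"
    proof
      assume "k < j"
      moreover have "bump T X (R, k) = bump T X (R, j)" using k v by (simp add: bump_def)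
      ultimately show False using D E by (auto simp: D_cells_iff)
    qed
    moreover have "(R, j) \<in> X" if "j < k"
    proof -
      have "T (R, j) \<le> v"
        using SSYT_row[OF S, of R j k] that D E k unfolding D_cells_iff by auto
      then show ?thesis using v by (auto simp: bump_def split: if_splits)
    qed
    ultimately show "(R, j) \<in> X" using k by (metis linorder_neqE_nat)
  qed
  then show ?thesis by auto
qed

text \<open>Every member of the interval above a bottom array determines that array; this yields
  disjointness.\<close>

lemma lower_bump:
  assumes "T \<in> Bottom r c t" "X \<subseteq> E_cells r c t T"
  shows "lower r c (bump T X) = T"
  by (simp add: lower_def D_cells_bump[OF assms]) (simp add: bump_def fun_eq_iff)

section \<open>Lowering all D-cells\<close>

text \<open>The free occurrences of a value form an initial segment of its occurrences in the row,
  so the leftmost occurrence is free as soon as some occurrence is.\<close>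

lemma D_cells_above_less:
  assumes T: "T \<in> SSYT r c t" and D: "(R, j) \<in> D_cells r c T" and S: "S \<in> {1..<R}"
  shows "T (S, j) + 1 < T (R, j)"
proof -
  note D' = D[unfolded D_cells_iff]
  have "free_occurrences c T R (T (R, j)) \<noteq> {}"
    using D' by (metis card.empty even_zero)
  then obtain k where k: "k \<in> {1..c}" "T (R, k) = T (R, j)" "R = 1 \<or> T (R - 1, k) + 1 \<noteq> T (R, j)"
    by (auto simp: free_occurrences_def occurrences_def)
  have R: "R \<noteq> 1" "R \<in> {1..r}" "R - 1 \<in> {1..r}" "j \<in> {1..c}" using S D' by auto
  \<comment> \<open>The comparison runs along row \<open>R - 1\<close>: the entry above the leftmost
    occurrence \<open>j\<close> is at most the one above the free occurrence \<open>k\<close>, which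
    is at least two below the common value.\<close>
  have "j \<le> k" using k D' by (metis atLeastLessThan_iff atLeastAtMost_iff not_le)
  then have "T (R - 1, j) \<le> T (R - 1, k)" using SSYT_row[OF T] R k by blast
  moreover have "T (R - 1, k) < T (R, k)" using SSYT_above[OF T] R k by blast
  moreover have "T (S, j) \<le> T (R - 1, j)"
  proof (cases "S = R - 1")
    case False
    then have "S < R - 1" "S \<in> {1..r}" using S R by auto
    then show ?thesis using SSYT_column[OF T, of S "R - 1" j] R by simp
  qed simp
  ultimately show ?thesis using k R by linarith
qed

lemma D_cells_left_less:
  assumes "T \<in> SSYT r c t" "(R, j) \<in> D_cells r c T" "k \<in> {1..<j}"
  shows "T (R, k) < T (R, j)"
proof -
  have "T (R, k) \<noteq> T (R, j)" "R \<in> {1..r}" "j \<in> {1..c}"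
    using assms unfolding D_cells_iff by blast+
  then show ?thesis using SSYT_row[OF assms(1), of R k j] assms(3) by auto
qed

lemma lower_le: "lower r c T p \<le> T p"
  by (simp add: lower_def)

text \<open>Dual to \<open>bump_in_SSYT\<close>: a D-cell is strictly larger than the entries to its
  left and at least two larger than those above it.\<close>

lemma lower_in_SSYT:
  assumes T: "T \<in> SSYT r c t"
  shows "lower r c T \<in> SSYT r c t"
proof -
  have "lower r c T \<in> {1..r} \<times> {1..c} \<rightarrow>\<^sub>E {0..r + t - 1}"
  proof (rule PiE_I)
    fix p assume "p \<in> {1..r} \<times> {1..c}"
    then show "lower r c T p \<in> {0..r + t - 1}"
      using SSYT_mem[OF T] lower_le[of r c T p] by (fastforce simp: PiE_def Pi_def)
  next
    fix p assume "p \<notin> {1..r} \<times> {1..c}"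
    then show "lower r c T p = undefined"
      using SSYT_mem[OF T] by (cases p) (auto simp: lower_def D_cells_iff PiE_def extensional_def)
  qed
  moreover have "lower r c T (R, j) \<le> lower r c T (R, k)"
    if "R \<in> {1..r}" "j \<in> {1..c}" "k \<in> {1..c}" "j < k" for R j k
  proof (cases "(R, k) \<in> D_cells r c T")
    case True
    then have "T (R, j) < T (R, k)" using D_cells_left_less[OF T] that by auto
    then show ?thesis using lower_le[of r c T "(R, j)"] True by (simp add: lower_def)
  next
    case False
    then show ?thesis using SSYT_row[OF T, of R j k] that by (auto simp: lower_def)
  qed
  moreover have "lower r c T (R, j) < lower r c T (S, j)"
    if "j \<in> {1..c}" "R \<in> {1..r}" "S \<in> {1..r}" "R < S" for R S j
  proof (cases "(S, j) \<in> D_cells r c T")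
    case True
    then have "T (R, j) + 1 < T (S, j)" using D_cells_above_less[OF T] that by auto
    then show ?thesis using lower_le[of r c T "(R, j)"] True by (simp add: lower_def)
  next
    case False
    then show ?thesis using SSYT_column[OF T, of R S j] that by (auto simp: lower_def)
  qed
  ultimately show ?thesis by (auto simp: SSYT_def)
qed

text \<open>Lowering turns odd entries into even ones, so it creates no \<open>v + 1\<close>. An
  entry above a \<open>v + 1\<close> is at most \<open>v\<close>: if it equals \<open>v\<close> it
  is even and stays, and otherwise lowering cannot bring it to \<open>v\<close>.\<close>

lemma free_occurrences_lower:
  assumes T: "T \<in> SSYT r c t" and R: "R \<in> {1..r}" and v: "even v"
  shows "free_occurrences c (lower r c T) R (v + 1) =
    free_occurrences c T R (v + 1) - {j. (R, j) \<in> D_cells r c T}"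
proof -
  have od: "odd (T p)" if "p \<in> D_cells r c T" for p
    using that by (cases p) (simp add: D_cells_iff)
  have occ: "lower r c T (R, j) = v + 1 \<longleftrightarrow> T (R, j) = v + 1 \<and> (R, j) \<notin> D_cells r c T" for j
  proof (cases "(R, j) \<in> D_cells r c T")
    case True
    then obtain w where "T (R, j) = 2 * w + 1" using od[OF True] by (elim oddE)
    then show ?thesis using True v by (auto simp: lower_def) (metis even_Suc dvd_triv_left)
  qed (simp add: lower_def)
  have above: "lower r c T (R - 1, j) = v \<longleftrightarrow> T (R - 1, j) = v"
    if "j \<in> {1..c}" "R \<noteq> 1" "T (R, j) = v + 1" for j
    using SSYT_above[OF T R, of j] that od[of "(R - 1, j)"] v by (auto simp: lower_def)
  show ?thesis
    using above occ unfolding free_occurrences_def occurrences_def by auto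
qed

text \<open>If the count is odd, the leftmost \<open>v + 1\<close> is a free D-cell and the only
  D-cell of that value in the row, so exactly one free occurrence disappears. If it is even, the row
  has no D-cell of value \<open>v + 1\<close>.\<close>

lemma even_card_free_occurrences_lower:
  assumes T: "T \<in> SSYT r c t" and R: "R \<in> {1..r}" and v: "even v"
  shows "even (card (free_occurrences c (lower r c T) R (v + 1)))"
proof (cases "odd (card (free_occurrences c T R (v + 1)))")
  case True
  define F where "F = free_occurrences c T R (v + 1)"
  have "F \<noteq> {}" using True by (auto simp: F_def)
  then have "occurrences c T R (v + 1) \<noteq> {}" by (auto simp: F_def free_occurrences_def)
  then obtain j where j: "j \<in> {1..c}" "T (R, j) = v + 1" "\<forall>k\<in>{1..<j}. T (R, k) \<noteq> v + 1"
    using Min_occurrences_iff by metis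
  have D: "(R, j) \<in> D_cells r c T" using j True R v by (simp add: D_cells_iff)
  have "j \<in> F"
  proof -
    have "T (R - 1, j) + 1 \<noteq> v + 1" if "R \<noteq> 1"
    proof -
      have "R - 1 \<in> {1..<R}" using that R by auto
      then show ?thesis using D_cells_above_less[OF T D] j by fastforce
    qed
    then show ?thesis using j by (auto simp: F_def free_occurrences_def occurrences_def)
  qed
  have "k = j" if "k \<in> F" "(R, k) \<in> D_cells r c T" for k
  proof -
    have k: "k \<in> {1..c}" "T (R, k) = v + 1"
      using that by (auto simp: F_def free_occurrences_def occurrences_def)
    then have "\<not> k < j" using j by auto
    moreover have "\<not> j < k" using D_cells_left_less[OF T that(2), of j] j k by auto
    ultimately show ?thesis by simp
  qed
  then have "F - {k. (R, k) \<in> D_cells r c T} = F - {j}" using D by blast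
  then have "card (free_occurrences c (lower r c T) R (v + 1)) = card F - 1"
    using free_occurrences_lower[OF T R v] \<open>j \<in> F\<close> by (simp add: F_def)
  then show ?thesis using True by (simp add: F_def)
next
  case False
  then have "free_occurrences c T R (v + 1) \<inter> {j. (R, j) \<in> D_cells r c T} = {}"
    by (auto simp: D_cells_iff free_occurrences_def occurrences_def)
  then show ?thesis
    using free_occurrences_lower[OF T R v] False by (simp add: Diff_triv)
qed

lemma lower_in_Bottom:
  assumes "T \<in> SSYT r c t"
  shows "lower r c T \<in> Bottom r c t"
  unfolding Bottom_iff
proof (intro conjI ballI allI impI)
  fix R v :: nat assume R: "R \<in> {1..r}" and "odd v"
  then obtain w where "even w" "v = w + 1" by (elim oddE) (metis dvd_triv_left)
  then show "even (card (free_occurrences c (lower r c T) R v))"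
    using even_card_free_occurrences_lower[OF assms R] by blast
qed (rule lower_in_SSYT[OF assms])

text \<open>Lowering the leftmost \<open>v + 1\<close> makes it the rightmost \<open>v\<close>:
  entries to its right were at least \<open>v + 1\<close>, and none equal to \<open>v + 1\<close> is
  a second D-cell.\<close>

lemma D_cells_subset_E_cells_lower:
  assumes T: "T \<in> SSYT r c t"
  shows "D_cells r c T \<subseteq> E_cells r c t (lower r c T)"
proof -
  have "(R, j) \<in> E_cells r c t (lower r c T)" if D: "(R, j) \<in> D_cells r c T" for R j
  proof -
    note D' = D[unfolded D_cells_iff]
    have "odd (T (R, j))" using D' by blast
    then obtain v where v: "even v" "T (R, j) = v + 1" by (elim oddE) (metis dvd_triv_left)
    have l: "lower r c T (R, j) = v" using D v by (simp add: lower_def)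
    have od: "odd (T p)" if "p \<in> D_cells r c T" for p
      using that by (cases p) (simp add: D_cells_iff)
    have "T (R, j) \<le> r + t - 1" using SSYT_mem[OF T] D' by (fastforce simp: PiE_def Pi_def)
    moreover have "lower r c T (R, k) \<noteq> v" if k: "k \<in> {j<..c}" for k
    proof -
      have "T (R, j) \<le> T (R, k)" using SSYT_row[OF T, of R j k] k D' by auto
      moreover have "T (R, j) < T (R, k)" if "(R, k) \<in> D_cells r c T"
        using D_cells_left_less[OF T that, of j] k D' by auto
      ultimately show ?thesis using v by (auto simp: lower_def)
    qed
    moreover have "lower r c T (R + 1, j) \<noteq> v + 1" if "R \<noteq> r"
    proof -
      have "v + 1 < T (R + 1, j)" using SSYT_column[OF T, of R "R + 1" j] that D' v by auto
      \<comment> \<open>If the cell below is lowered as well, its entry becomes even and so differs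
        from the odd \<open>v + 1\<close>.\<close>
      moreover have "lower r c T (R + 1, j) \<noteq> v + 1" if "(R + 1, j) \<in> D_cells r c T"
      proof -
        have "even (lower r c T (R + 1, j))" using od[OF that] that by (simp add: lower_def)
        then show ?thesis using v by auto
      qed
      ultimately show ?thesis by (auto simp: lower_def)
    qed
    moreover have "even (card (free_occurrences c (lower r c T) R (v + 1)))"
      using even_card_free_occurrences_lower[OF T] D' v by blast
    ultimately show ?thesis
      unfolding E_cells_iff l using D' v by auto
  qed
  then show ?thesis by auto
qed

lemma bump_lower: "bump (lower r c T) (D_cells r c T) = T"
proof -
  \<comment> \<open>Entries on D-cells are odd, hence positive, so the natural subtraction in
    \<open>lower\<close> is exact.\<close>
  have "0 < T p" if "p \<in> D_cells r c T" for p
    using that by (cases p) (auto simp: D_cells_iff odd_pos)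
  then show ?thesis by (auto simp: bump_def lower_def fun_eq_iff)
qed

section \<open>Intervals as copies of power sets\<close>

text \<open>The order compares only cells of the array, hence the hypothesis on
  \<open>X\<close>.\<close>

lemma bump_le_iff:
  assumes "X \<subseteq> {1..r} \<times> {1..c}"
  shows "bump T X \<sqsubseteq>\<^bsub>SSYT_poset r c t\<^esub> bump T Y \<longleftrightarrow> X \<subseteq> Y"
proof -
  have "bump T X p \<le> bump T Y p \<longleftrightarrow> (p \<in> X \<longrightarrow> p \<in> Y)" for p
    by (simp add: bump_def)
  then show ?thesis using assms by (auto simp: SSYT_poset_def)
qed

lemma E_cells_subset: "E_cells r c t T \<subseteq> {1..r} \<times> {1..c}"
  by (auto simp: E_cells_iff)

text \<open>Between \<open>T\<close> and its top, an E-cell has two possible entries and every other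
  cell one, so a member is determined by the set of E-cells it raises.\<close>

lemma interval_eq_bump_image:
  assumes T: "T \<in> SSYT r c t"
  shows "\<lbrace>T..T_top r c t T\<rbrace>\<^bsub>SSYT_poset r c t\<^esub> = bump T ` Pow (E_cells r c t T)" (is "?I = ?J")
proof
  show "?J \<subseteq> ?I"
  proof
    fix U assume "U \<in> ?J"
    then obtain X where X: "X \<subseteq> E_cells r c t T" "U = bump T X" by blast
    have "bump T {} \<sqsubseteq>\<^bsub>SSYT_poset r c t\<^esub> U" "U \<sqsubseteq>\<^bsub>SSYT_poset r c t\<^esub> T_top r c t T"
      using X E_cells_subset[of r c t T] by (simp_all add: bump_le_iff T_top_eq_bump subset_trans)
    moreover have "bump T {} = T" by (simp add: bump_def)
    ultimately show "U \<in> ?I"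
      using bump_in_SSYT[OF T] X by (simp add: at_least_at_most_def) (simp add: SSYT_poset_def)
  qed
next
  show "?I \<subseteq> ?J"
  proof
    fix U assume "U \<in> ?I"
    then have U: "U \<in> SSYT r c t"
      and le: "\<And>p. p \<in> {1..r} \<times> {1..c} \<Longrightarrow> T p \<le> U p \<and> U p \<le> bump T (E_cells r c t T) p"
      by (auto simp: at_least_at_most_def SSYT_poset_def T_top_eq_bump)
    define X where "X = {p \<in> E_cells r c t T. U p = T p + 1}"
    have "U p = bump T X p" for p
    proof (cases "p \<in> {1..r} \<times> {1..c}")
      case True
      then show ?thesis using le[OF True] by (auto simp: X_def bump_def split: if_splits)
    next
      case False
      \<comment> \<open>Outside the array both tableaux are \<open>undefined\<close> by
        extensionality, and \<open>bump\<close> does not act there.\<close>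
      then have "p \<notin> X" using E_cells_subset[of r c t T] by (auto simp: X_def)
      then show ?thesis
        using PiE_arb[OF SSYT_mem[OF T] False] PiE_arb[OF SSYT_mem[OF U] False]
        by (simp add: bump_def)
    qed
    then have "U = bump T X" by blast
    moreover have "X \<subseteq> E_cells r c t T" by (auto simp: X_def)
    ultimately show "U \<in> ?J" by blast
  qed
qed

lemma boolean_lattice_interval:
  assumes T: "T \<in> SSYT r c t"
  shows "boolean_lattice (SSYT_poset r c t\<lparr>carrier := \<lbrace>T..T_top r c t T\<rbrace>\<^bsub>SSYT_poset r c t\<^esub>\<rparr>)"
proof (rule boolean_lattice_if_Pow_iso)
  show "bij_betw (bump T) (Pow (E_cells r c t T))
    (carrier (SSYT_poset r c t\<lparr>carrier := \<lbrace>T..T_top r c t T\<rbrace>\<^bsub>SSYT_poset r c t\<^esub>\<rparr>))"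
    by (auto simp: bij_betw_def interval_eq_bump_image[OF T] inj_on_def bump_def fun_eq_iff
        split: if_splits)
next
  fix X Y assume "X \<subseteq> E_cells r c t T" "Y \<subseteq> E_cells r c t T"
  then show "bump T X \<sqsubseteq>\<^bsub>SSYT_poset r c t\<lparr>carrier := \<lbrace>T..T_top r c t T\<rbrace>\<^bsub>SSYT_poset r c t\<^esub>\<rparr>\<^esub> bump T Y
      \<longleftrightarrow> X \<subseteq> Y"
    using bump_le_iff[of X r c t T Y] E_cells_subset[of r c t T] by auto
qed (simp add: SSYT_poset_def)

theorem theorem5p10:
  fixes r c t :: nat
  assumes "r \<ge> 1" and "c \<ge> 1" and "t \<ge> 1"
  defines "P \<equiv> SSYT_poset r c t"
  shows "(\<forall>T\<in>Bottom r c t. T_top r c t T \<in> SSYT r c t \<and>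
            boolean_lattice (P\<lparr>carrier := \<lbrace>T..T_top r c t T\<rbrace>\<^bsub>P\<^esub>\<rparr>)) \<and>
         SSYT r c t = (\<Union>T\<in>Bottom r c t. \<lbrace>T..T_top r c t T\<rbrace>\<^bsub>P\<^esub>) \<and>
         disjoint_family_on (\<lambda>T. \<lbrace>T..T_top r c t T\<rbrace>\<^bsub>P\<^esub>) (Bottom r c t)"
proof (intro conjI ballI)
  have S: "T \<in> SSYT r c t" if "T \<in> Bottom r c t" for T
    using that by (simp add: Bottom_def)
  show "T_top r c t T \<in> SSYT r c t" if "T \<in> Bottom r c t" for T
    using bump_in_SSYT[OF S[OF that]] by (simp add: T_top_eq_bump)
  show "boolean_lattice (P\<lparr>carrier := \<lbrace>T..T_top r c t T\<rbrace>\<^bsub>P\<^esub>\<rparr>)" if "T \<in> Bottom r c t" for T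
    unfolding P_def by (rule boolean_lattice_interval[OF S[OF that]])
  show "SSYT r c t = (\<Union>T\<in>Bottom r c t. \<lbrace>T..T_top r c t T\<rbrace>\<^bsub>P\<^esub>)"
  proof
    show "SSYT r c t \<subseteq> (\<Union>T\<in>Bottom r c t. \<lbrace>T..T_top r c t T\<rbrace>\<^bsub>P\<^esub>)"
    proof
      fix T assume T: "T \<in> SSYT r c t"
      \<comment> \<open>The bottom array for \<open>T\<close> is \<open>lower r c T\<close>, and
        raising the former D-cells leads back to \<open>T\<close>.\<close>
      have "T \<in> bump (lower r c T) ` Pow (E_cells r c t (lower r c T))"
        using D_cells_subset_E_cells_lower[OF T] by (metis PowI bump_lower imageI)
      then show "T \<in> (\<Union>T\<in>Bottom r c t. \<lbrace>T..T_top r c t T\<rbrace>\<^bsub>P\<^esub>)"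
        using lower_in_Bottom[OF T] interval_eq_bump_image[OF lower_in_SSYT[OF T]]
        unfolding P_def by blast
    qed
  qed (auto simp: P_def interval_eq_bump_image[OF S] bump_in_SSYT[OF S])
  show "disjoint_family_on (\<lambda>T. \<lbrace>T..T_top r c t T\<rbrace>\<^bsub>P\<^esub>) (Bottom r c t)"
    \<comment> \<open>On a common element of two intervals, \<open>lower r c\<close> returns both
      bottom arrays, so they coincide.\<close>
    unfolding disjoint_family_on_def P_def
    by (auto simp: interval_eq_bump_image[OF S]) (metis lower_bump)
qed

end
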